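(* Let $\Gamma$ be a discrete, finitely generated group, and let $S\subseteq\Gamma$ be a finite symmetric generating set with $e\in S$. Suppose that there is a sequence of finite sets $F_n\subseteq\Gamma$, with $e\in F_n$ for every $n$, such that $$\frac{|F_nSF_n^{-1}|}{|F_n|^2}\longrightarrow 0\qquad (n\to\infty).$$ Then $\Gamma$ has fixed price one.
   Context: For subsets $A,B,C$ of a group, $ABC=\{abc: a\in A,b\in B,c\in C\}$ and $A^{-1}=\{a^{-1}:a\in A\}$; $|A|$ is cardinality; $e$ is the identity; symmetric means $S=S^{-1}$. Cost. Let $(X,\mu)$ be a standard probability space and $\mathcal R$ a countable probability-measure-preserving (pmp) equivalence relation on $X$. A graphing of $\mathcal R$ is a countable family $\Phi=\{\varphi_i:A_i\to B_i\}_{i\in I}$ of measure-preserving Borel isomorphisms between Borel subsets of $X$ with $(x,\varphi_i(x))\in\mathcal R$ for all $i\in I$, $x\in A_i$. It defines a graph on $X$ by joining $x$ to $\varphi_i(x)$; $\Phi$ generates $\mathcal R$ if, on a conull subset of $X$, the connected components of this graph are precisely the $\mathcal R$-classes. Put $\operatorname{cost}(\Phi)=\sum_{i}\mu(A_i)$ and $\operatorname{cost}(\mathcal R)=\inf\{\operatorname{cost}(\Phi):\Phi \text{ is a graphing that generates }\mathcal R\}$. For an essentially free pmp action $\Gamma\curvearrowright(X,\mu)$ of a countable group, $\operatorname{cost}(\Gamma\curvearrowright X)$ is the cost of its orbit equivalence relation. A countable group has fixed price one if every essentially free pmp action of it (on a standard probability space) has cost $1$. *)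

theory Defs
  imports "HOL-Probability.Probability_Measure" "HOL-Algebra.Algebra"
begin

definition standard_borel :: "'x measure \<Rightarrow> bool" where
  "standard_borel M \<longleftrightarrow>
     (\<exists>T. completely_metrizable_space T \<and> second_countable T \<and> topspace T = space M \<and>
          sets M = sigma_sets (space M) {U. openin T U})"

text \<open>Atoms are allowed.\<close>

definition standard_prob_space :: "'x measure \<Rightarrow> bool" where
  "standard_prob_space M \<longleftrightarrow> prob_space M \<and> standard_borel M"

definition mp_borel_iso :: "'x measure \<Rightarrow> 'x set \<Rightarrow> 'x set \<Rightarrow> ('x \<Rightarrow> 'x) \<Rightarrow> bool" where
  "mp_borel_iso M A B f \<longleftrightarrow>
     A \<in> sets M \<and> B \<in> sets M \<and> bij_betw f A B \<and>
     f \<in> measurable (restrict_space M A) (restrict_space M B) \<and>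
     the_inv_into A f \<in> measurable (restrict_space M B) (restrict_space M A) \<and>
     distr (restrict_space M A) (restrict_space M B) f = restrict_space M B"

text \<open>A graphing is a family of partial isomorphisms \<open>f i : A i \<rightarrow> B i\<close> with \<open>i \<in> I\<close>. Since
  \<open>I\<close> is countable, there is no loss in taking it to be a set of natural numbers (finite or
  infinite).\<close>

definition graphing ::
  "'x measure \<Rightarrow> ('x \<times> 'x) set \<Rightarrow> nat set \<Rightarrow> (nat \<Rightarrow> 'x set) \<Rightarrow> (nat \<Rightarrow> 'x set) \<Rightarrow>
    (nat \<Rightarrow> 'x \<Rightarrow> 'x) \<Rightarrow> bool" where
  "graphing M R I A B f \<longleftrightarrow>
     (\<forall>i\<in>I. mp_borel_iso M (A i) (B i) (f i) \<and> (\<forall>x\<in>A i. (x, f i x) \<in> R))"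

definition graphing_edges ::
  "nat set \<Rightarrow> (nat \<Rightarrow> 'x set) \<Rightarrow> (nat \<Rightarrow> 'x \<Rightarrow> 'x) \<Rightarrow> ('x \<times> 'x) set" where
  "graphing_edges I A f = {(x, f i x) | i x. i \<in> I \<and> x \<in> A i}"

definition graph_component :: "('x \<times> 'x) set \<Rightarrow> 'x \<Rightarrow> 'x set" where
  "graph_component E x = (E \<union> E\<inverse>)\<^sup>* `` {x}"

definition generates ::
  "'x measure \<Rightarrow> ('x \<times> 'x) set \<Rightarrow> nat set \<Rightarrow> (nat \<Rightarrow> 'x set) \<Rightarrow> (nat \<Rightarrow> 'x \<Rightarrow> 'x) \<Rightarrow> bool" where
  "generates M R I A f \<longleftrightarrow> (AE x in M. graph_component (graphing_edges I A f) x = R `` {x})"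

definition graphing_cost :: "'x measure \<Rightarrow> nat set \<Rightarrow> (nat \<Rightarrow> 'x set) \<Rightarrow> ennreal" where
  "graphing_cost M I A = (\<Sum>\<^sub>\<infinity>i\<in>I. emeasure M (A i))"

definition cost :: "'x measure \<Rightarrow> ('x \<times> 'x) set \<Rightarrow> ennreal" where
  "cost M R = Inf {graphing_cost M I A | I A B f. graphing M R I A B f \<and> generates M R I A f}"

definition pmp_action :: "('g, 'b) monoid_scheme \<Rightarrow> 'x measure \<Rightarrow> ('g \<Rightarrow> 'x \<Rightarrow> 'x) \<Rightarrow> bool" where
  "pmp_action G M \<phi> \<longleftrightarrow>
     group_action G (space M) \<phi> \<and>
     (\<forall>g\<in>carrier G. \<phi> g \<in> measurable M M \<and> distr M M (\<phi> g) = M)"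

definition essentially_free ::
  "('g, 'b) monoid_scheme \<Rightarrow> 'x measure \<Rightarrow> ('g \<Rightarrow> 'x \<Rightarrow> 'x) \<Rightarrow> bool" where
  "essentially_free G M \<phi> \<longleftrightarrow> (AE x in M. \<forall>g\<in>carrier G. g \<noteq> \<one>\<^bsub>G\<^esub> \<longrightarrow> \<phi> g x \<noteq> x)"

definition orbit_rel ::
  "('g, 'b) monoid_scheme \<Rightarrow> 'x measure \<Rightarrow> ('g \<Rightarrow> 'x \<Rightarrow> 'x) \<Rightarrow> ('x \<times> 'x) set" where
  "orbit_rel G M \<phi> = {(x, y). x \<in> space M \<and> y \<in> orbit G \<phi> x}"

text \<open>HOL cannot quantify over types inside a formula, so the type of points of the probability
  spaces is a parameter. Fixed price one is the assertion for every \<open>'x\<close>, that is, with \<open>'x\<close> a free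
  type variable of the theorem.\<close>

definition fixed_price_one :: "'x itself \<Rightarrow> ('g, 'b) monoid_scheme \<Rightarrow> bool" where
  "fixed_price_one (_ :: 'x itself) G \<longleftrightarrow>
     countable (carrier G) \<and>
     (\<forall>(M :: 'x measure) \<phi>.
        standard_prob_space M \<and> pmp_action G M \<phi> \<and> essentially_free G M \<phi> \<longrightarrow>
        cost M (orbit_rel G M \<phi>) = 1)"

end

theory Submission
  imports Defs "HOL-Probability.Product_PMF"
begin

text \<open>
  Let \<open>\<phi>\<close> be an essentially free pmp action on \<open>M\<close> and put \<open>K = F S F\<inverse>\<close>. Everything rests on a
  set \<open>A\<close> of points that behaves, on the scale of \<open>K\<close>, like a random subset of the orbits which
  contains each point independently with probability \<open>p = c / |F|\<close>, where \<open>c\<close> is a large constant.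

  Upper bound. Call \<open>x\<close> covered if \<open>\<phi> f x \<in> A\<close> for some \<open>f \<in> F\<close>. Three kinds of edges generate the
  orbit relation. Stars: each covered \<open>x\<close> is joined to one such point \<open>\<phi> f x\<close>; as every point
  chooses at most once, this costs at most 1. Links: any two points of \<open>A\<close> that differ by an element
  of \<open>K - {\<one>}\<close> are joined; by pairwise independence this costs about
  \<open>|K| p\<^sup>2 = c\<^sup>2 |K| / |F|\<^sup>2\<close>, which tends to 0 by hypothesis. Leftovers: each uncovered point keeps
  all its edges in the Cayley graph of \<open>S\<close>; this costs about
  \<open>|S| (1 - p)\<^bsup>|F|\<^esup> \<le> |S| exp (- c)\<close>. If \<open>x\<close> and \<open>\<phi> s x\<close> are both covered, by \<open>f\<close> and \<open>f'\<close>, then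
  the centres of their stars differ by \<open>f' s f\<inverse> \<in> K\<close>, so that they coincide or a link joins them
  (\<open>cost_le_stars_links_uncovered\<close>).

  Such a set exists in every free action, by a first-moment argument
  (\<open>exists_almost_independent_set\<close>). Cut the space into finitely many Borel cells, so fine
  that for all points \<open>x\<close> outside a set of tiny measure the translates of \<open>x\<close> by \<open>K\<close> lie in different
  cells, and let \<open>A\<close> be the union of the cells that win independent coin tosses. By Fubini, the
  expected value of each of the measures above is what independence predicts, up to the tiny error,
  so some outcome of the tosses does at least as well as the average.

  Lower bound. The points of \<open>A\<close> together with the uncovered points meet every orbit, and their measure is as
  small as desired because \<open>1 / |F| \<le> |K| / |F|\<^sup>2\<close>. In a graph that generates the relation, send each
  point outside such a set \<open>Z\<close> along an edge that decreases the distance to \<open>Z\<close>. An edge is used in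
  one direction only, so the graphing costs at least \<open>1 - \<mu>(Z)\<close>
  (\<open>measure_space_le_section_plus_graphing_cost\<close>).
\<close>

section \<open>Complete sections and the lower bound for the cost\<close>

lemma graphing_cost_eq_suminf:
  "graphing_cost M I A = suminf (\<lambda>n. if n \<in> I then emeasure M (A n) else 0)"
proof -
  have "graphing_cost M I A = (\<Sum>\<^sub>\<infinity>n. if n \<in> I then emeasure M (A n) else 0)"
    unfolding graphing_cost_def by (rule infsum_cong_neutral) auto
  also have "\<dots> = suminf (\<lambda>n. if n \<in> I then emeasure M (A n) else 0)"
    by (intro sums_unique has_sum_imp_sums has_sum_infsum nonneg_summable_on_complete) simp
  finally show ?thesis .
qed

lemma mp_borel_iso_image:
  assumes "mp_borel_iso M A B f" "C \<in> sets M" "C \<subseteq> A"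
  shows "f ` C \<in> sets M" "emeasure M (f ` C) = emeasure M C"
proof -
  have A: "A \<in> sets M" and B: "B \<in> sets M" and bij: "bij_betw f A B"
    and f: "f \<in> measurable (restrict_space M A) (restrict_space M B)"
    and inv: "the_inv_into A f \<in> measurable (restrict_space M B) (restrict_space M A)"
    and d: "distr (restrict_space M A) (restrict_space M B) f = restrict_space M B"
    using assms unfolding mp_borel_iso_def by auto
  have sp: "space (restrict_space M A) = A" "space (restrict_space M B) = B"
    using A B by (auto simp: space_restrict_space dest: sets.sets_into_space)
  have inj: "inj_on f A" and img: "f ` A = B"
    using bij by (auto simp: bij_betw_def)
  have C: "C \<in> sets (restrict_space M A)"
    using assms A by (subst sets_restrict_space_iff) auto
  have "the_inv_into A f -` C \<inter> space (restrict_space M B) \<in> sets (restrict_space M B)"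
    by (rule measurable_sets[OF inv C])
  also have "the_inv_into A f -` C \<inter> space (restrict_space M B) = f ` C"
    using inj img assms(3) unfolding sp
    by (auto simp: the_inv_into_f_f subset_iff)
  finally have fC: "f ` C \<in> sets (restrict_space M B)" .
  then show "f ` C \<in> sets M"
    using B by (subst (asm) sets_restrict_space_iff) auto
  have "emeasure M (f ` C) = emeasure (restrict_space M B) (f ` C)"
    using B assms(3) img by (subst emeasure_restrict_space) auto
  also have "\<dots> = emeasure (distr (restrict_space M A) (restrict_space M B) f) (f ` C)"
    by (simp only: d)
  also have "\<dots> = emeasure (restrict_space M A) (f -` (f ` C) \<inter> A)"
    using f fC by (subst emeasure_distr) (auto simp: sp)
  also have "f -` (f ` C) \<inter> A = C"
    using inj assms(3) by (auto simp: inj_on_def)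
  also have "emeasure (restrict_space M A) C = emeasure M C"
    using A assms(3) by (subst emeasure_restrict_space) auto
  finally show "emeasure M (f ` C) = emeasure M C" .
qed

lemma mp_borel_iso_preimage:
  assumes "mp_borel_iso M A B f" "C \<in> sets M"
  shows "{x \<in> A. f x \<in> C} \<in> sets M"
proof -
  have A: "A \<in> sets M" and B: "B \<in> sets M" and bij: "bij_betw f A B"
    and f: "f \<in> measurable (restrict_space M A) (restrict_space M B)"
    using assms unfolding mp_borel_iso_def by auto
  have "C \<inter> B \<in> sets (restrict_space M B)"
    using assms B by (subst sets_restrict_space_iff) auto
  from measurable_sets[OF f this]
  have "f -` (C \<inter> B) \<inter> space (restrict_space M A) \<in> sets M"
    using A by (subst (asm) sets_restrict_space_iff) auto
  also have "f -` (C \<inter> B) \<inter> space (restrict_space M A) = {x \<in> A. f x \<in> C}"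
    using A bij by (auto simp: space_restrict_space bij_betw_def dest: sets.sets_into_space)
  finally show ?thesis .
qed

text \<open>
  The distance \<open>d\<close> to \<open>Z\<close> is finite almost everywhere, and every point with \<open>d > 0\<close> has a neighbour
  that is closer to \<open>Z\<close>. Hence it lies in the set \<open>P i\<close> of points that \<open>f i\<close> brings closer, or in the
  image of the set \<open>Q i\<close> of points that \<open>f i\<close> takes further away. These two subsets of \<open>A i\<close> are
  disjoint, and \<open>f i\<close> preserves measure. Covering the complement of \<open>Z\<close> by these sets takes the
  place of a measurable choice of shortest paths. On the null set that no path joins to \<open>Z\<close>, the
  value of \<open>d\<close> is arbitrary.
\<close>
lemma measure_space_le_section_plus_graphing_cost:
  assumes g: "graphing M R I A B f" and Z: "Z \<in> sets M"
    and meets: "AE x in M. graph_component (graphing_edges I A f) x \<inter> Z \<noteq> {}"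
  shows "emeasure M (space M) \<le> emeasure M Z + graphing_cost M I A"
proof -
  define E where "E = graphing_edges I A f"
  define D where "D n = ((E \<union> E\<inverse>) ^^ n) `` Z" for n
  define d where "d x = (LEAST n. x \<in> D n)" for x
  have iso: "mp_borel_iso M (A i) (B i) (f i)" if "i \<in> I" for i
    using g that by (auto simp: graphing_def)
  have A: "A i \<in> sets M" and into: "f i ` A i \<subseteq> space M" if "i \<in> I" for i
    using iso[OF that] sets.sets_into_space[of "B i" M]
    by (auto simp: mp_borel_iso_def bij_betw_def)
  have D0: "D 0 = Z"
    by (simp add: D_def)
  \<comment> \<open>This description of the balls around \<open>Z\<close> shows that they are measurable.\<close>
  have DSuc: "D (Suc n) = (\<Union>i\<in>I. f i ` (A i \<inter> D n)) \<union> (\<Union>i\<in>I. {x \<in> A i. f i x \<in> D n})" for n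
  proof -
    have "D (Suc n) = (E \<union> E\<inverse>) `` D n"
      by (auto simp: D_def)
    also have "\<dots> = (\<Union>i\<in>I. f i ` (A i \<inter> D n)) \<union> (\<Union>i\<in>I. {x \<in> A i. f i x \<in> D n})"
      by (auto simp: E_def graphing_edges_def Image_iff) blast
    finally show ?thesis .
  qed
  have Dm [measurable]: "D n \<in> sets M" for n
  proof (induction n)
    case 0
    then show ?case by (simp add: D0 Z)
  next
    case (Suc n)
    have "f i ` (A i \<inter> D n) \<in> sets M" "{x \<in> A i. f i x \<in> D n} \<in> sets M" if "i \<in> I" for i
      using mp_borel_iso_image(1)[OF iso[OF that]] mp_borel_iso_preimage[OF iso[OF that] Suc]
        A[OF that] Suc by auto
    then show ?case
      unfolding DSuc by (intro sets.Un sets.countable_UN') auto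
  qed
  have d [measurable]: "d \<in> measurable M (count_space UNIV)"
    unfolding d_def by measurable
  define P where "P i = {x \<in> A i. d (f i x) < d x}" for i
  define Q where "Q i = {x \<in> A i. d x < d (f i x)}" for i
  have PQ: "P i \<in> sets M" "Q i \<in> sets M" if i: "i \<in> I" for i
  proof -
    have lev: "{x \<in> A i. f i x \<in> {y \<in> space M. d y = n}} \<in> sets M" for n
      by (rule mp_borel_iso_preimage[OF iso[OF i]]) measurable
    have "P i = (\<Union>n. {x \<in> A i. f i x \<in> {y \<in> space M. d y = n}} \<inter> {x \<in> space M. n < d x})"
      using into[OF i] sets.sets_into_space[OF A[OF i]] by (auto simp: P_def)
    also have "\<dots> \<in> sets M"
      using lev by measurable
    finally show "P i \<in> sets M" .
    have "Q i = (\<Union>n. {x \<in> A i. f i x \<in> {y \<in> space M. d y = n}} \<inter> {x \<in> space M. d x < n})"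
      using into[OF i] sets.sets_into_space[OF A[OF i]] by (auto simp: Q_def)
    also have "\<dots> \<in> sets M"
      using lev by measurable
    finally show "Q i \<in> sets M" .
  qed
  have fQ: "f i ` Q i \<in> sets M" "emeasure M (f i ` Q i) = emeasure M (Q i)" if i: "i \<in> I" for i
    using mp_borel_iso_image[OF iso[OF i] PQ(2)[OF i]] by (auto simp: Q_def)
  define H where "H i = (if i \<in> I then P i \<union> f i ` Q i else {})" for i
  have H: "H i \<in> sets M" for i
    using PQ fQ by (auto simp: H_def)
  have le: "emeasure M (H i) \<le> (if i \<in> I then emeasure M (A i) else 0)" for i
  proof (cases "i \<in> I")
    case i: True
    have "emeasure M (H i) \<le> emeasure M (P i) + emeasure M (Q i)"
      using i emeasure_subadditive[OF PQ(1) fQ(1), of i i] fQ(2)[of i] by (simp add: H_def)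
    also have "\<dots> = emeasure M (P i \<union> Q i)"
      using PQ[OF i] by (intro plus_emeasure) (auto simp: P_def Q_def)
    also have "\<dots> \<le> emeasure M (A i)"
      using A[OF i] by (intro emeasure_mono) (auto simp: P_def Q_def)
    finally show ?thesis using i by simp
  qed (simp add: H_def)
  have cover: "x \<in> Z \<union> (\<Union>i. H i)" if x: "graph_component E x \<inter> Z \<noteq> {}" for x
  proof -
    obtain z where "z \<in> Z" "(x, z) \<in> (E \<union> E\<inverse>)\<^sup>*"
      using x by (auto simp: graph_component_def)
    moreover have "sym ((E \<union> E\<inverse>)\<^sup>*)"
      by (intro sym_rtrancl sym_Un_converse)
    ultimately have "(z, x) \<in> (E \<union> E\<inverse>)\<^sup>*"
      by (auto dest: symD)
    then obtain n where "x \<in> D n"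
      using \<open>z \<in> Z\<close> by (auto simp: D_def rtrancl_power)
    then have dx: "x \<in> D (d x)"
      unfolding d_def by (rule LeastI)
    show ?thesis
    proof (cases "d x")
      case 0
      then show ?thesis using dx D0 by simp
    next
      case (Suc n)
      have le_n: "d y < d x" if "y \<in> D n" for y
        using that Suc unfolding d_def by (metis Least_le less_Suc_eq_le)
      from dx have "x \<in> D (Suc n)" by (simp add: Suc)
      then consider i y where "i \<in> I" "y \<in> A i" "y \<in> D n" "x = f i y"
        | i where "i \<in> I" "x \<in> A i" "f i x \<in> D n"
        unfolding DSuc by blast
      then show ?thesis
      proof cases
        case 1
        then have "x \<in> f i ` Q i" using le_n[of y] by (auto simp: Q_def)
        then show ?thesis using 1 by (auto simp: H_def)
      next
        case 2
        then have "x \<in> P i" using le_n[of "f i x"] by (auto simp: P_def)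
        then show ?thesis using 2 by (auto simp: H_def)
      qed
    qed
  qed
  have "emeasure M (space M) \<le> emeasure M (Z \<union> (\<Union>i. H i))"
    using meets cover Z H unfolding E_def[symmetric]
    by (intro emeasure_mono_AE) (auto elim!: eventually_mono)
  also have "\<dots> \<le> emeasure M Z + emeasure M (\<Union>i. H i)"
    using Z H by (intro emeasure_subadditive) auto
  also have "emeasure M (\<Union>i. H i) \<le> suminf (\<lambda>i. emeasure M (H i))"
    using H by (intro emeasure_subadditive_countably) auto
  also have "\<dots> \<le> graphing_cost M I A"
    unfolding graphing_cost_eq_suminf using le by (intro suminf_le) auto
  finally show ?thesis
    by (simp add: add_left_mono)
qed

section \<open>Random sets that are nearly independent along translates\<close>

text \<open>
  A countable base of a Polish topology separates points, because the topology is Hausdorff. The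
  standard Borel structure enters through these sets, which cut the space into measurable cells.
\<close>
lemma standard_borel_separating_sequence:
  fixes M :: "'x measure"
  assumes "standard_borel M"
  shows "\<exists>U :: nat \<Rightarrow> 'x set. (\<forall>n. U n \<in> sets M) \<and>
    (\<forall>x\<in>space M. \<forall>y\<in>space M. x \<noteq> y \<longrightarrow> (\<exists>n. (x \<in> U n) \<noteq> (y \<in> U n)))"
proof -
  obtain T where T: "completely_metrizable_space T" "second_countable T"
    and sp: "topspace T = space M" and sts: "sets M = sigma_sets (space M) {U. openin T U}"
    using assms by (auto simp: standard_borel_def)
  obtain \<B> where \<B>: "countable \<B>" "\<And>V. V \<in> \<B> \<Longrightarrow> openin T V"
    and base: "\<And>U x. openin T U \<Longrightarrow> x \<in> U \<Longrightarrow> \<exists>V\<in>\<B>. x \<in> V \<and> V \<subseteq> U"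
    using T(2) by (auto simp: second_countable_def)
  define U where "U = from_nat_into (insert {} \<B>)"
  have range: "range U = insert {} \<B>"
    unfolding U_def using \<B>(1) by (intro range_from_nat_into) auto
  have "U n \<in> sets M" for n
  proof -
    have "openin T (U n)"
      using rangeI[of U n] \<B>(2) unfolding range by auto
    then show ?thesis
      unfolding sts by (auto intro: sigma_sets.Basic)
  qed
  moreover have "\<exists>n. (x \<in> U n) \<noteq> (y \<in> U n)"
    if xy: "x \<in> space M" "y \<in> space M" "x \<noteq> y" for x y
  proof -
    have "Hausdorff_space T"
      using T(1) completely_metrizable_imp_metrizable_space metrizable_imp_Hausdorff_space by blast
    then obtain V W where VW: "openin T V" "openin T W" "x \<in> V" "y \<in> W" "disjnt V W"
      using xy unfolding Hausdorff_space_def sp by blast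
    then obtain V' where V': "V' \<in> \<B>" "x \<in> V'" "V' \<subseteq> V"
      using base by meson
    then obtain n where "U n = V'"
      using range by (metis insertI2 rangeE)
    then show ?thesis
      using V' VW by (auto simp: disjnt_iff)
  qed
  ultimately show ?thesis
    by (intro exI[of _ U]) simp
qed

text \<open>
  The cell \<open>\<pi> x\<close> records which of the first \<open>N\<close> separating sets contain \<open>x\<close>. Distinct points have
  distinct cells once \<open>N\<close> is large, so the exceptional sets for \<open>N = 0, 1, 2, \<dots>\<close> decrease to a null set.
  Their measurability is part of the conclusion because \<open>emeasure\<close> is 0 on nonmeasurable sets, where
  the bound alone would be empty.
\<close>
lemma exists_separating_finite_partition:
  fixes t :: "'j \<Rightarrow> 'x \<Rightarrow> 'x"
  assumes M: "prob_space M" "standard_borel M" and K: "finite K"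
    and t: "\<And>g. g \<in> K \<Longrightarrow> t g \<in> measurable M M"
    and inj: "AE x in M. inj_on (\<lambda>g. t g x) K" and "\<delta> > (0 :: ennreal)"
  obtains \<pi> :: "'x \<Rightarrow> nat set" and J :: "nat set set"
  where "finite J" "\<pi> \<in> measurable M (count_space J)"
    and "{x \<in> space M. \<not> inj_on (\<lambda>g. \<pi> (t g x)) K} \<in> sets M"
    and "emeasure M {x \<in> space M. \<not> inj_on (\<lambda>g. \<pi> (t g x)) K} < \<delta>"
proof -
  interpret prob_space M by (rule M)
  obtain U :: "nat \<Rightarrow> 'x set" where U: "\<forall>n. U n \<in> sets M"
    and sep: "\<forall>x\<in>space M. \<forall>y\<in>space M. x \<noteq> y \<longrightarrow> (\<exists>n. (x \<in> U n) \<noteq> (y \<in> U n))"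
    using standard_borel_separating_sequence[OF M(2)] by (elim exE conjE) (rule that)
  define \<pi> where "\<pi> N x = {n. n < N \<and> x \<in> U n}" for N :: nat and x
  have \<pi>: "\<pi> N \<in> measurable M (count_space (Pow {..<N}))" for N
  proof -
    have "\<pi> N -` {a} \<inter> space M \<in> sets M" if a: "a \<in> Pow {..<N}" for a
    proof -
      define V where "V n = (if n \<in> a then U n else space M - U n)" for n
      have V [measurable]: "V n \<in> sets M" for n
        using U by (simp add: V_def sets.compl_sets)
      have "\<pi> N x = a \<longleftrightarrow> (\<forall>n\<in>{..<N}. x \<in> V n)" if "x \<in> space M" for x
        using a that unfolding \<pi>_def V_def by (simp add: set_eq_iff subset_eq) blast
      then have "\<pi> N -` {a} \<inter> space M = {x \<in> space M. \<forall>n\<in>{..<N}. x \<in> V n}"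
        by blast
      also have "\<dots> \<in> sets M"
        by measurable
      finally show ?thesis .
    qed
    moreover have "\<pi> N \<in> space M \<rightarrow> Pow {..<N}"
      by (auto simp: \<pi>_def)
    ultimately show ?thesis
      by (subst measurable_count_space_eq2) blast+
  qed
  define Bd where "Bd N = {x \<in> space M. \<not> inj_on (\<lambda>g. \<pi> N (t g x)) K}" for N
  have Bd: "Bd N \<in> sets M" for N
  proof -
    have J: "\<pi> N y \<in> Pow {..<N}" for y
      unfolding \<pi>_def by blast
    have cell: "{x \<in> space M. \<pi> N (t g x) = a} \<in> sets M" if g: "g \<in> K" and a: "a \<in> Pow {..<N}" for g a
    proof -
      have "(\<lambda>x. \<pi> N (t g x)) \<in> measurable M (count_space (Pow {..<N}))"
        by (rule measurable_compose[OF t[OF g] \<pi>])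
      then have "(\<lambda>x. \<pi> N (t g x)) -` {a} \<inter> space M \<in> sets M"
        by (rule measurable_sets) (use a in simp)
      then show ?thesis
        by (simp add: vimage_def Int_def conj_commute)
    qed
    have "Bd N = (\<Union>g\<in>K. \<Union>h\<in>K - {g}. \<Union>a\<in>Pow {..<N}.
        {x \<in> space M. \<pi> N (t g x) = a} \<inter> {x \<in> space M. \<pi> N (t h x) = a})"
      using J unfolding Bd_def inj_on_def by blast
    also have "\<dots> \<in> sets M"
      using K cell by (intro sets.finite_UN sets.Int) auto
    finally show ?thesis .
  qed
  have anti: "decseq Bd"
  proof (rule antimonoI)
    fix m N :: nat
    assume "m \<le> N"
    then have "\<pi> m y = \<pi> N y \<inter> {..<m}" for y
      by (auto simp: \<pi>_def)
    then have "\<pi> m y = \<pi> m z" if "\<pi> N y = \<pi> N z" for y z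
      using that by simp
    then show "Bd N \<subseteq> Bd m"
      unfolding Bd_def inj_on_def by blast
  qed
  have null: "emeasure M (\<Inter>N. Bd N) = 0"
  proof -
    have *: "x \<notin> (\<Inter>N. Bd N)" if x: "inj_on (\<lambda>g. t g x) K" "x \<in> space M" for x
    proof -
      have "\<forall>\<^sub>F N in sequentially. \<pi> N (t g x) \<noteq> \<pi> N (t h x)" if gh: "g \<in> K" "h \<in> K" "g \<noteq> h" for g h
      proof -
        have "t g x \<noteq> t h x" "t g x \<in> space M" "t h x \<in> space M"
          using gh x t by (auto dest: inj_onD measurable_space)
        then obtain n where "(t g x \<in> U n) \<noteq> (t h x \<in> U n)"
          using sep by blast
        then have "\<pi> N (t g x) \<noteq> \<pi> N (t h x)" if "n < N" for N
          using that unfolding \<pi>_def by blast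
        then show ?thesis
          by (rule eventually_mono[OF eventually_gt_at_top[of n]])
      qed
      then have "\<forall>\<^sub>F N in sequentially. g \<noteq> h \<longrightarrow> \<pi> N (t g x) \<noteq> \<pi> N (t h x)"
        if "g \<in> K" "h \<in> K" for g h
        using that by (cases "g = h") auto
      then have "\<forall>\<^sub>F N in sequentially. \<forall>g\<in>K. \<forall>h\<in>K. g \<noteq> h \<longrightarrow> \<pi> N (t g x) \<noteq> \<pi> N (t h x)"
        using K by (intro eventually_ball_finite ballI) blast+
      then obtain N where "\<forall>g\<in>K. \<forall>h\<in>K. g \<noteq> h \<longrightarrow> \<pi> N (t g x) \<noteq> \<pi> N (t h x)"
        using eventually_happens'[OF sequentially_bot] by blast
      then have "x \<notin> Bd N"
        by (auto simp: Bd_def inj_on_def)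
      then show ?thesis by blast
    qed
    have "AE x in M. x \<notin> (\<Inter>N. Bd N)"
      using inj AE_space[of M] by eventually_elim (rule *)
    moreover have "(\<Inter>N. Bd N) \<in> sets M"
      using Bd by (intro sets.countable_INT) auto
    ultimately show ?thesis
      using AE_iff_null_sets by blast
  qed
  have "(\<lambda>N. emeasure M (Bd N)) \<longlonglongrightarrow> emeasure M (\<Inter>N. Bd N)"
    using Bd anti by (intro Lim_emeasure_decseq) auto
  then have "\<forall>\<^sub>F N in sequentially. emeasure M (Bd N) < \<delta>"
    unfolding null using \<open>\<delta> > 0\<close> by (rule order_tendstoD)
  then obtain N where "emeasure M (Bd N) < \<delta>"
    using eventually_happens'[OF sequentially_bot] by blast
  then show ?thesis
    using that[OF _ \<pi>[of N]] Bd[of N] by (simp add: Bd_def)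
qed

lemma nn_integral_pmf_emeasure_swap:
  fixes W :: "'w pmf"
  assumes "finite (set_pmf W)" "\<And>\<omega>. {x \<in> space M. P x \<omega>} \<in> sets M"
  shows "(\<integral>\<^sup>+\<omega>. emeasure M {x \<in> space M. P x \<omega>} \<partial>measure_pmf W)
       = (\<integral>\<^sup>+x. emeasure (measure_pmf W) {\<omega>. P x \<omega>} \<partial>M)"
proof -
  note assms(2)[measurable]
  have "(\<integral>\<^sup>+\<omega>. emeasure M {x \<in> space M. P x \<omega>} \<partial>measure_pmf W)
      = (\<Sum>\<omega>\<in>set_pmf W. emeasure M {x \<in> space M. P x \<omega>} * pmf W \<omega>)"
    by (rule nn_integral_measure_pmf_finite) (use assms in auto)
  also have "\<dots> = (\<Sum>\<omega>\<in>set_pmf W. \<integral>\<^sup>+x. indicator {x \<in> space M. P x \<omega>} x * ennreal (pmf W \<omega>) \<partial>M)"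
    by (simp add: nn_integral_multc)
  also have "\<dots> = (\<integral>\<^sup>+x. (\<Sum>\<omega>\<in>set_pmf W. indicator {x \<in> space M. P x \<omega>} x * ennreal (pmf W \<omega>)) \<partial>M)"
    by (rule nn_integral_sum[symmetric]) measurable
  also have "\<dots> = (\<integral>\<^sup>+x. emeasure (measure_pmf W) {\<omega>. P x \<omega>} \<partial>M)"
  proof (rule nn_integral_cong)
    fix x assume x: "x \<in> space M"
    have "emeasure (measure_pmf W) {\<omega>. P x \<omega>} = (\<integral>\<^sup>+\<omega>. indicator {\<omega>. P x \<omega>} \<omega> \<partial>measure_pmf W)"
      by simp
    also have "\<dots> = (\<Sum>\<omega>\<in>set_pmf W. indicator {\<omega>. P x \<omega>} \<omega> * ennreal (pmf W \<omega>))"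
      by (rule nn_integral_measure_pmf_finite) (use assms in auto)
    finally show "(\<Sum>\<omega>\<in>set_pmf W. indicator {x \<in> space M. P x \<omega>} x * ennreal (pmf W \<omega>))
        = emeasure (measure_pmf W) {\<omega>. P x \<omega>}"
      using x by (simp add: indicator_def)
  qed
  finally show ?thesis .
qed

lemma emeasure_Pi_pmf_bernoulli:
  assumes "finite J" "C \<subseteq> J" "0 \<le> p" "p \<le> 1"
  shows "emeasure (Pi_pmf J False (\<lambda>_. bernoulli_pmf p)) {\<omega>. \<forall>c\<in>C. \<omega> c = b}
       = ennreal ((if b then p else 1 - p) ^ card C)"
proof -
  define W where "W = Pi_pmf J False (\<lambda>_. bernoulli_pmf p)"
  have "measure_pmf.prob (bernoulli_pmf p) {b} = (if b then p else 1 - p)"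
    using assms by (simp add: measure_pmf_single)
  then have "measure_pmf.prob W (Pi J (\<lambda>c. if c \<in> C then {b} else UNIV))
       = (\<Prod>c\<in>J. if c \<in> C then (if b then p else 1 - p) else 1)"
    unfolding W_def using assms(1)
    by (subst measure_Pi_pmf_Pi) (auto intro!: prod.cong)
  also have "\<dots> = (if b then p else 1 - p) ^ card C"
    using assms(1,2) by (simp add: prod.If_cases Int_absorb1)
  also have "Pi J (\<lambda>c. if c \<in> C then {b} else UNIV) = {\<omega>. \<forall>c\<in>C. \<omega> c = b}"
    using assms(2) by (auto simp: Pi_def split: if_splits)
  finally show ?thesis
    by (simp add: measure_pmf.emeasure_eq_measure W_def)
qed

text \<open>
  With \<open>A\<close> the union of the cells that win a toss of a \<open>p\<close>-coin, the coins met by \<open>x\<close> at its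
  translates \<open>t g x\<close> are independent unless two translates share a cell. So the three expected
  measures are at most \<open>p\<close>, \<open>(1 - p)\<^bsup>|F|\<^esup> + \<delta>\<close> and \<open>p\<^sup>2 + \<delta>\<close>. The claim bounds one weighted sum of
  the measures, rather than each of them, so that a single outcome can serve all of them. The
  index \<open>e\<close> plays the part of the identity: the point \<open>x\<close> itself is \<open>t e x\<close>.
\<close>
lemma exists_almost_independent_set:
  fixes t :: "'j \<Rightarrow> 'x \<Rightarrow> 'x" and a :: nat and p \<eta> :: real
  assumes M: "prob_space M" "standard_borel M"
    and K: "finite K" "F \<subseteq> K" "e \<in> K"
    and t: "\<And>g. g \<in> K \<Longrightarrow> t g \<in> measurable M M"
    and te: "\<And>x. x \<in> space M \<Longrightarrow> t e x = x"
    and inj: "AE x in M. inj_on (\<lambda>g. t g x) K"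
    and p: "0 \<le> p" "p \<le> 1" and \<eta>: "0 < \<eta>"
  shows "\<exists>A\<in>sets M. emeasure M A + of_nat a * emeasure M {x \<in> space M. \<forall>f\<in>F. t f x \<notin> A}
      + (\<Sum>g\<in>K - {e}. emeasure M {x \<in> space M. x \<in> A \<and> t g x \<in> A})
      < ennreal (p + real a * (1 - p) ^ card F + real (card K) * p\<^sup>2 + \<eta>)"
proof -
  interpret prob_space M by (rule M)
  \<comment> \<open>The error \<open>\<delta>\<close> enters with total weight \<open>a + |K - {e}|\<close>, so the sum of errors stays below \<open>\<eta>\<close>.\<close>
  define \<delta> where "\<delta> = \<eta> / (real a + real (card K))"
  have K0: "0 < card K"
    using K by (auto simp: card_gt_0_iff)
  have \<delta>: "0 < \<delta>"
    using \<eta> K0 by (simp add: \<delta>_def)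
  obtain \<pi> :: "'x \<Rightarrow> nat set" and J where J: "finite J"
    and \<pi>: "\<pi> \<in> measurable M (count_space J)"
    and bad: "{x \<in> space M. \<not> inj_on (\<lambda>g. \<pi> (t g x)) K} \<in> sets M"
    and bad_less: "emeasure M {x \<in> space M. \<not> inj_on (\<lambda>g. \<pi> (t g x)) K} < ennreal \<delta>"
    by (rule exists_separating_finite_partition[OF M K(1) t inj, of "ennreal \<delta>"])
      (use \<delta> in auto)
  define Bd where "Bd = {x \<in> space M. \<not> inj_on (\<lambda>g. \<pi> (t g x)) K}"
  have Bd: "Bd \<in> sets M" "emeasure M Bd \<le> ennreal \<delta>"
    using bad bad_less by (simp_all add: Bd_def)
  define W where "W = Pi_pmf J False (\<lambda>_. bernoulli_pmf p)"
  have fin: "finite (set_pmf W)"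
    unfolding W_def using J by (subst set_Pi_pmf) (auto intro!: finite_PiE_dflt)
  define A where "A \<omega> = {x \<in> space M. \<omega> (\<pi> x)}" for \<omega>
  have A [measurable]: "A \<omega> \<in> sets M" for \<omega>
    unfolding A_def using measurable_compose[OF \<pi>, of \<omega> "count_space UNIV"] by (simp add: pred_def)
  have tsp: "t g x \<in> space M" if "g \<in> K" "x \<in> space M" for g x
    using measurable_space[OF t] that by blast
  have \<pi>J: "\<pi> x \<in> J" if "x \<in> space M" for x
    using measurable_space[OF \<pi> that] by simp
  have le1: "emeasure (measure_pmf W) C \<le> 1" for C
    by (rule measure_pmf.emeasure_le_1)
  define U where "U \<omega> = {x \<in> space M. \<forall>f\<in>F. t f x \<notin> A \<omega>}" for \<omega>
  define L where "L g \<omega> = {x \<in> space M. x \<in> A \<omega> \<and> t g x \<in> A \<omega>}" for g \<omega>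
  have finF: "finite F"
    using K finite_subset by blast
  have tA: "{x \<in> space M. t g x \<in> A \<omega>} \<in> sets M" if "g \<in> K" for g \<omega>
    using measurable_sets[OF t[OF that] A] by (simp add: vimage_def Int_def conj_commute)
  have U: "U \<omega> \<in> sets M" for \<omega>
  proof -
    have "U \<omega> = space M - (\<Union>f\<in>F. {x \<in> space M. t f x \<in> A \<omega>})"
      unfolding U_def by blast
    then show ?thesis
      using finF K(2) tA by (simp add: sets.compl_sets sets.finite_UN subset_iff)
  qed
  have L: "L g \<omega> \<in> sets M" if "g \<in> K" for g \<omega>
  proof -
    have "L g \<omega> = A \<omega> \<inter> {x \<in> space M. t g x \<in> A \<omega>}"
      unfolding L_def A_def by blast
    then show ?thesis
      using tA[OF that] A by simp
  qed
  have int_bad: "(\<integral>\<^sup>+x. ennreal c + indicator Bd x \<partial>M) \<le> ennreal c + ennreal \<delta>" for c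
    using Bd by (subst nn_integral_add) (auto simp: emeasure_space_1 add_left_mono)
  have EA: "(\<integral>\<^sup>+\<omega>. emeasure M (A \<omega>) \<partial>measure_pmf W) \<le> ennreal p"
  proof -
    have "(\<integral>\<^sup>+\<omega>. emeasure M (A \<omega>) \<partial>measure_pmf W)
        = (\<integral>\<^sup>+x. emeasure (measure_pmf W) {\<omega>. \<omega> (\<pi> x)} \<partial>M)"
      using A unfolding A_def by (intro nn_integral_pmf_emeasure_swap fin)
    also have "\<dots> = (\<integral>\<^sup>+x. ennreal p \<partial>M)"
    proof (rule nn_integral_cong)
      fix x assume "x \<in> space M"
      then show "emeasure (measure_pmf W) {\<omega>. \<omega> (\<pi> x)} = ennreal p"
        using emeasure_Pi_pmf_bernoulli[of J "{\<pi> x}" p True] J \<pi>J p by (simp add: W_def)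
    qed
    finally show ?thesis
      by (simp add: emeasure_space_1)
  qed
  have EU: "(\<integral>\<^sup>+\<omega>. emeasure M (U \<omega>) \<partial>measure_pmf W) \<le> ennreal ((1 - p) ^ card F) + ennreal \<delta>"
  proof -
    have "(\<integral>\<^sup>+\<omega>. emeasure M (U \<omega>) \<partial>measure_pmf W)
        = (\<integral>\<^sup>+x. emeasure (measure_pmf W) {\<omega>. \<forall>f\<in>F. t f x \<notin> A \<omega>} \<partial>M)"
      using U unfolding U_def by (intro nn_integral_pmf_emeasure_swap fin)
    also have "\<dots> \<le> (\<integral>\<^sup>+x. ennreal ((1 - p) ^ card F) + indicator Bd x \<partial>M)"
    proof (rule nn_integral_mono)
      fix x assume x: "x \<in> space M"
      show "emeasure (measure_pmf W) {\<omega>. \<forall>f\<in>F. t f x \<notin> A \<omega>}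
          \<le> ennreal ((1 - p) ^ card F) + indicator Bd x"
      proof (cases "x \<in> Bd")
        case True
        then show ?thesis using le1 by (simp add: add_increasing)
      next
        case False
        then have "inj_on (\<lambda>g. \<pi> (t g x)) F"
          using x K(2) by (auto simp: Bd_def intro: inj_on_subset)
        then have "card ((\<lambda>g. \<pi> (t g x)) ` F) = card F"
          by (rule card_image)
        moreover have "{\<omega>. \<forall>f\<in>F. t f x \<notin> A \<omega>} = {\<omega>. \<forall>c\<in>(\<lambda>g. \<pi> (t g x)) ` F. \<omega> c = False}"
          using x tsp K(2) by (auto simp: A_def)
        moreover have "(\<lambda>g. \<pi> (t g x)) ` F \<subseteq> J"
          using x tsp K(2) \<pi>J by blast
        ultimately show ?thesis
          using emeasure_Pi_pmf_bernoulli[of J "(\<lambda>g. \<pi> (t g x)) ` F" p False] J p False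
          by (simp add: W_def)
      qed
    qed
    also note int_bad
    finally show ?thesis .
  qed
  have EL: "(\<integral>\<^sup>+\<omega>. emeasure M (L g \<omega>) \<partial>measure_pmf W) \<le> ennreal (p\<^sup>2) + ennreal \<delta>"
    if g: "g \<in> K - {e}" for g
  proof -
    have "(\<integral>\<^sup>+\<omega>. emeasure M (L g \<omega>) \<partial>measure_pmf W)
        = (\<integral>\<^sup>+x. emeasure (measure_pmf W) {\<omega>. x \<in> A \<omega> \<and> t g x \<in> A \<omega>} \<partial>M)"
      using L g unfolding L_def by (intro nn_integral_pmf_emeasure_swap fin) blast
    also have "\<dots> \<le> (\<integral>\<^sup>+x. ennreal (p\<^sup>2) + indicator Bd x \<partial>M)"
    proof (rule nn_integral_mono)
      fix x assume x: "x \<in> space M"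
      show "emeasure (measure_pmf W) {\<omega>. x \<in> A \<omega> \<and> t g x \<in> A \<omega>}
          \<le> ennreal (p\<^sup>2) + indicator Bd x"
      proof (cases "x \<in> Bd")
        case True
        then show ?thesis using le1 by (simp add: add_increasing)
      next
        case False
        then have "inj_on (\<lambda>g. \<pi> (t g x)) K"
          using x by (simp add: Bd_def)
        then have "\<pi> (t e x) \<noteq> \<pi> (t g x)"
          using g K(3) by (auto dest: inj_onD)
        then have "card {\<pi> x, \<pi> (t g x)} = 2"
          using x te by simp
        moreover have "{\<omega>. x \<in> A \<omega> \<and> t g x \<in> A \<omega>} = {\<omega>. \<forall>c\<in>{\<pi> x, \<pi> (t g x)}. \<omega> c = True}"
          using x tsp[of g x] g by (auto simp: A_def)
        moreover have "{\<pi> x, \<pi> (t g x)} \<subseteq> J"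
          using x tsp[of g x] g \<pi>J by blast
        ultimately show ?thesis
          using emeasure_Pi_pmf_bernoulli[of J "{\<pi> x, \<pi> (t g x)}" p True] J p False
          by (simp add: W_def)
      qed
    qed
    also note int_bad
    finally show ?thesis .
  qed
  define tot where "tot \<omega> = emeasure M (A \<omega>) + of_nat a * emeasure M (U \<omega>)
      + (\<Sum>g\<in>K - {e}. emeasure M (L g \<omega>))" for \<omega>
  define b where "b = p + real a * (1 - p) ^ card F + real (card K) * p\<^sup>2 + \<eta>"
  have "(\<integral>\<^sup>+\<omega>. tot \<omega> \<partial>measure_pmf W) = (\<integral>\<^sup>+\<omega>. emeasure M (A \<omega>) \<partial>measure_pmf W)
      + of_nat a * (\<integral>\<^sup>+\<omega>. emeasure M (U \<omega>) \<partial>measure_pmf W)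
      + (\<Sum>g\<in>K - {e}. \<integral>\<^sup>+\<omega>. emeasure M (L g \<omega>) \<partial>measure_pmf W)"
    by (simp add: tot_def nn_integral_add nn_integral_sum nn_integral_cmult)
  also have "\<dots> \<le> ennreal p + of_nat a * (ennreal ((1 - p) ^ card F) + ennreal \<delta>)
      + (\<Sum>g\<in>K - {e}. ennreal (p\<^sup>2) + ennreal \<delta>)"
    by (intro add_mono mult_left_mono sum_mono EA EU EL) auto
  also have "\<dots> = ennreal (p + real a * ((1 - p) ^ card F + \<delta>)
      + real (card (K - {e})) * (p\<^sup>2 + \<delta>))"
    using p \<delta> by (simp add: ennreal_mult ennreal_of_nat_eq_real_of_nat del: card_Diff_insert card_Diff_singleton)
  also have "\<dots> < ennreal b"
  proof -
    have card: "real (card (K - {e})) = real (card K) - 1"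
      using K K0 by (simp add: of_nat_diff)
    have "(real a + real (card K)) * \<delta> = \<eta>"
      using K0 by (simp add: \<delta>_def)
    then have "p + real a * ((1 - p) ^ card F + \<delta>) + real (card (K - {e})) * (p\<^sup>2 + \<delta>)
        = b - p\<^sup>2 - \<delta>"
      unfolding card b_def by (simp add: algebra_simps)
    also have "\<dots> < b"
      using \<delta> zero_le_power2[of p] by linarith
    finally show ?thesis
      using p \<delta> by (intro ennreal_lessI) (auto simp: b_def intro!: add_nonneg_pos add_nonneg_nonneg \<eta>)
  qed
  finally have less: "(\<integral>\<^sup>+\<omega>. tot \<omega> \<partial>measure_pmf W) < ennreal b" .
  have "\<exists>\<omega>. tot \<omega> < ennreal b"
  proof (rule ccontr)
    assume "\<not> ?thesis"
    then have "(\<integral>\<^sup>+\<omega>. ennreal b \<partial>measure_pmf W) \<le> (\<integral>\<^sup>+\<omega>. tot \<omega> \<partial>measure_pmf W)"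
      by (intro nn_integral_mono) (simp add: not_less)
    then show False
      using less by (simp add: measure_pmf.emeasure_space_1)
  qed
  then obtain \<omega> where "tot \<omega> < ennreal b" ..
  then show ?thesis
    using A[of \<omega>] unfolding tot_def b_def U_def L_def by blast
qed

section \<open>Graphings by restrictions of group elements\<close>

lemma mp_borel_iso_group_element:
  fixes G (structure)
  assumes act: "pmp_action G M \<phi>" and g: "g \<in> carrier G" and D: "D \<in> sets M"
  shows "mp_borel_iso M D (\<phi> g ` D) (\<phi> g)"
proof -
  interpret group_action G "space M" \<phi>
    using act by (simp add: pmp_action_def)
  interpret group G
    using group_hom by (rule group_hom.axioms(1))
  have meas: "\<phi> h \<in> measurable M M" and distr: "distr M M (\<phi> h) = M" if "h \<in> carrier G" for h
    using act that by (auto simp: pmp_action_def)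
  have DM: "D \<subseteq> space M"
    using D by (rule sets.sets_into_space)
  have g': "inv g \<in> carrier G"
    using g by simp
  have left: "\<phi> (inv g) (\<phi> g x) = x" if "x \<in> space M" for x
    using orbit_sym_aux[OF g that refl] .
  have right: "\<phi> g (\<phi> (inv g) x) = x" if "x \<in> space M" for x
    using orbit_sym_aux[OF g' that refl] g by simp
  have sp: "\<phi> g x \<in> space M" "\<phi> (inv g) x \<in> space M" if "x \<in> space M" for x
    using measurable_space[OF meas] g g' that by blast+
  have "\<phi> g ` D = \<phi> (inv g) -` D \<inter> space M"
    using left right sp DM by (auto simp: image_iff) (metis right)
  then have B: "\<phi> g ` D \<in> sets M"
    using measurable_sets[OF meas[OF g'] D] by simp
  have inj: "inj_on (\<phi> g) D"
    using inj_prop[OF g] DM by (rule inj_on_subset)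
  have spD: "space (restrict_space M D) = D" "space (restrict_space M (\<phi> g ` D)) = \<phi> g ` D"
    using DM B by (auto simp: space_restrict_space dest: sets.sets_into_space)
  have f: "\<phi> g \<in> measurable (restrict_space M D) (restrict_space M (\<phi> g ` D))"
    by (intro measurable_restrict_space2 measurable_restrict_space1 meas g) (simp add: spD)
  have "\<phi> (inv g) \<in> measurable (restrict_space M (\<phi> g ` D)) (restrict_space M D)"
    using left DM by (intro measurable_restrict_space2 measurable_restrict_space1 meas g') (auto simp: spD)
  moreover have "the_inv_into D (\<phi> g) y = \<phi> (inv g) y" if "y \<in> \<phi> g ` D" for y
    using that left DM by (auto simp: the_inv_into_f_f[OF inj])
  ultimately have finv: "the_inv_into D (\<phi> g) \<in> measurable (restrict_space M (\<phi> g ` D)) (restrict_space M D)"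
    by (subst measurable_cong[where g = "\<phi> (inv g)"]) (simp_all add: spD)
  have "distr (restrict_space M D) (restrict_space M (\<phi> g ` D)) (\<phi> g) = restrict_space M (\<phi> g ` D)"
  proof (rule measure_eqI)
    fix C assume "C \<in> sets (distr (restrict_space M D) (restrict_space M (\<phi> g ` D)) (\<phi> g))"
    then have CB: "C \<in> sets (restrict_space M (\<phi> g ` D))"
      by simp
    then have C: "C \<in> sets M" "C \<subseteq> \<phi> g ` D"
      using B by (simp_all add: sets_restrict_space_iff)
    have "\<phi> g -` C \<inter> space M = \<phi> g -` C \<inter> D"
      using C(2) DM left by (auto simp: subset_iff image_iff) (metis left)
    moreover have "emeasure M C = emeasure (distr M M (\<phi> g)) C"
      by (simp add: distr[OF g])
    ultimately have "emeasure M (\<phi> g -` C \<inter> D) = emeasure M C"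
      using emeasure_distr[OF meas[OF g] C(1)] by simp
    then show "emeasure (distr (restrict_space M D) (restrict_space M (\<phi> g ` D)) (\<phi> g)) C
        = emeasure (restrict_space M (\<phi> g ` D)) C"
      using D B C(2) by (simp add: emeasure_distr[OF f CB] spD emeasure_restrict_space)
  qed simp
  then show ?thesis
    using D B f finv inj by (simp add: mp_borel_iso_def bij_betw_def)
qed

text \<open>
  A graphing is obtained from restrictions of group elements, with one partial isomorphism for each
  \<open>g \<in> J\<close>. It stays inside the orbits by construction; to reach whole orbits it is enough to connect
  \<open>x\<close> to \<open>\<phi> s x\<close> for generators \<open>s\<close>.
\<close>
lemma cost_orbit_rel_le_sum:
  fixes G (structure) and \<phi> :: "'g \<Rightarrow> 'x \<Rightarrow> 'x"
  assumes act: "pmp_action G M \<phi>" and gen: "generate G S = carrier G" and S: "S \<subseteq> carrier G"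
    and J: "finite J" "J \<subseteq> carrier G" and D: "\<And>g. g \<in> J \<Longrightarrow> D g \<in> sets M"
    and E: "E = {(x, \<phi> g x) | g x. g \<in> J \<and> x \<in> D g}"
    and conn: "\<And>x s. x \<in> space M \<Longrightarrow> s \<in> S \<Longrightarrow> (x, \<phi> s x) \<in> (E \<union> E\<inverse>)\<^sup>*"
  shows "cost M (orbit_rel G M \<phi>) \<le> (\<Sum>g\<in>J. emeasure M (D g))"
proof -
  interpret group_action G "space M" \<phi>
    using act by (simp add: pmp_action_def)
  interpret group G
    using group_hom by (rule group_hom.axioms(1))
  have sp: "\<phi> g x \<in> space M" if "g \<in> carrier G" "x \<in> space M" for g x
    using act that measurable_space[of "\<phi> g" M M x] by (simp add: pmp_action_def)
  have DM: "D g \<subseteq> space M" if "g \<in> J" for g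
    using D[OF that] by (rule sets.sets_into_space)
  obtain h where h: "bij_betw h {..<card J} J"
    using ex_bij_betw_nat_finite[OF J(1)] by (auto simp: atLeast0LessThan)
  then have hJ: "h i \<in> J" if "i < card J" for i
    using that by (auto simp: bij_betw_def)
  define R where "R = orbit_rel G M \<phi>"
  have sym: "(x, y) \<in> (E \<union> E\<inverse>)\<^sup>* \<Longrightarrow> (y, x) \<in> (E \<union> E\<inverse>)\<^sup>*" for x y
    using sym_rtrancl[OF sym_Un_converse[of E]] by (rule symD)
  have gr: "graphing M R {..<card J} (\<lambda>i. D (h i)) (\<lambda>i. \<phi> (h i) ` D (h i)) (\<lambda>i. \<phi> (h i))"
    unfolding graphing_def
  proof (intro ballI conjI)
    fix i assume i: "i \<in> {..<card J}"
    then show "mp_borel_iso M (D (h i)) (\<phi> (h i) ` D (h i)) (\<phi> (h i))"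
      using hJ J(2) D by (intro mp_borel_iso_group_element[OF act]) auto
    show "(x, \<phi> (h i) x) \<in> R" if "x \<in> D (h i)" for x
      using that hJ[of i] i J(2) DM[of "h i"] by (auto simp: R_def orbit_rel_def orbit_def)
  qed
  have edges: "graphing_edges {..<card J} (\<lambda>i. D (h i)) (\<lambda>i. \<phi> (h i)) = E"
  proof -
    have img: "h ` {..<card J} = J"
      using h by (simp add: bij_betw_def)
    have "e \<in> graphing_edges {..<card J} (\<lambda>i. D (h i)) (\<lambda>i. \<phi> (h i)) \<longleftrightarrow> e \<in> E" for e
    proof -
      have "e \<in> graphing_edges {..<card J} (\<lambda>i. D (h i)) (\<lambda>i. \<phi> (h i))
          \<longleftrightarrow> (\<exists>g\<in>h ` {..<card J}. \<exists>x\<in>D g. e = (x, \<phi> g x))"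
        unfolding graphing_edges_def by blast
      also have "\<dots> \<longleftrightarrow> e \<in> E"
        unfolding img E by blast
      finally show ?thesis .
    qed
    then show ?thesis by blast
  qed
  have all: "(x, \<phi> g x) \<in> (E \<union> E\<inverse>)\<^sup>*" if "g \<in> generate G S" "x \<in> space M" for g x
    using that
  proof (induction arbitrary: x rule: generate.induct)
    case one
    then show ?case
      using id_eq_one by (metis restrict_apply' rtrancl.rtrancl_refl)
  next
    case (incl s)
    then show ?case by (intro conn)
  next
    case (inv s)
    then have s: "s \<in> carrier G" "inv s \<in> carrier G"
      using S by auto
    have "\<phi> s (\<phi> (inv s) x) = x"
      using orbit_sym_aux[OF s(2) inv(2) refl] s by simp
    then have "(\<phi> (inv s) x, x) \<in> (E \<union> E\<inverse>)\<^sup>*"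
      using conn[OF sp[OF s(2) inv(2)] inv(1)] by simp
    then show ?case by (rule sym)
  next
    case (eng g1 g2)
    then have c: "g1 \<in> carrier G" "g2 \<in> carrier G"
      using gen by auto
    have "(x, \<phi> g2 x) \<in> (E \<union> E\<inverse>)\<^sup>*" "(\<phi> g2 x, \<phi> g1 (\<phi> g2 x)) \<in> (E \<union> E\<inverse>)\<^sup>*"
      using eng c sp by auto
    then show ?case
      using composition_rule[OF eng(5) c] by simp
  qed
  have comp: "graph_component E x = R `` {x}" if x: "x \<in> space M" for x
  proof
    show "R `` {x} \<subseteq> graph_component E x"
      using all gen x by (auto simp: R_def orbit_rel_def orbit_def graph_component_def)
    have "y \<in> orbit G \<phi> x" if "(x, y) \<in> (E \<union> E\<inverse>)\<^sup>*" for y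
      using that
    proof (induction rule: rtrancl_induct)
      case base
      then show ?case using orbit_refl[OF x] .
    next
      case (step y z)
      then obtain k where k: "k \<in> carrier G" "y = \<phi> k x"
        by (auto simp: orbit_def)
      have y: "y \<in> space M"
        using k sp x by simp
      have "\<exists>l\<in>carrier G. z = \<phi> l y"
      proof (cases "(y, z) \<in> E")
        case True
        then show ?thesis using J(2) by (auto simp: E)
      next
        case False
        then have "(z, y) \<in> E" using step by auto
        then obtain l where l: "l \<in> J" "z \<in> D l" "y = \<phi> l z" by (auto simp: E)
        then have "\<phi> (inv l) y = z"
          using DM[of l] J(2) by (intro orbit_sym_aux) auto
        then show ?thesis using l J(2) by (intro bexI[of _ "inv l"]) auto
      qed
      then obtain l where "l \<in> carrier G" "z = \<phi> l y" by blast
      then have "z = \<phi> (l \<otimes> k) x" "l \<otimes> k \<in> carrier G"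
        using composition_rule[OF x] k by auto
      then show ?case by (auto simp: orbit_def)
    qed
    then show "graph_component E x \<subseteq> R `` {x}"
      using x by (auto simp: R_def orbit_rel_def graph_component_def)
  qed
  have gens: "generates M R {..<card J} (\<lambda>i. D (h i)) (\<lambda>i. \<phi> (h i))"
    unfolding generates_def edges by (rule AE_I2) (rule comp)
  have "cost M R \<le> graphing_cost M {..<card J} (\<lambda>i. D (h i))"
    unfolding cost_def by (rule Inf_lower) (use gr gens in blast)
  also have "\<dots> = (\<Sum>i<card J. emeasure M (D (h i)))"
    by (simp add: graphing_cost_def)
  also have "\<dots> = (\<Sum>g\<in>J. emeasure M (D g))"
    using sum.reindex_bij_betw[OF h] .
  finally show ?thesis
    by (simp add: R_def)
qed

text \<open>
  The graphing of stars, links and leftover Cayley edges. Each of \<open>F\<close> and \<open>S\<close> lies in \<open>K = F S F\<inverse>\<close>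
  because \<open>\<one>\<close> lies in both, so all three kinds of edges fit into one domain \<open>D g\<close> for each \<open>g \<in> K\<close>.
  The symmetry of \<open>S\<close> handles an edge from a covered point \<open>x\<close> to an uncovered point \<open>\<phi> s x\<close>: it is
  the edge of \<open>\<phi> s x\<close> that belongs to the inverse of \<open>s\<close>.
\<close>
lemma cost_le_stars_links_uncovered:
  fixes G (structure) and \<phi> :: "'g \<Rightarrow> 'x \<Rightarrow> 'x"
  assumes act: "pmp_action G M \<phi>"
    and S: "finite S" "S \<subseteq> carrier G" "generate G S = carrier G" "set_inv S = S" "\<one> \<in> S"
    and F: "finite F" "F \<subseteq> carrier G" "\<one> \<in> F"
    and A: "A \<in> sets M"
  shows "cost M (orbit_rel G M \<phi>) \<le> emeasure M (space M)
      + of_nat (card S) * emeasure M {x \<in> space M. \<forall>f\<in>F. \<phi> f x \<notin> A}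
      + (\<Sum>g\<in>(F <#> S <#> set_inv F) - {\<one>}. emeasure M {x \<in> space M. x \<in> A \<and> \<phi> g x \<in> A})"
proof -
  interpret group_action G "space M" \<phi>
    using act by (simp add: pmp_action_def)
  interpret group G
    using group_hom by (rule group_hom.axioms(1))
  define K where "K = F <#> S <#> set_inv F"
  have inK: "f' \<otimes> s \<otimes> inv f \<in> K" if "f' \<in> F" "s \<in> S" "f \<in> F" for f' s f
    unfolding K_def set_mult_def SET_INV_def using that by blast
  have K: "finite K" "K \<subseteq> carrier G"
  proof -
    show "K \<subseteq> carrier G"
      using F S unfolding K_def set_mult_def SET_INV_def by auto
    show "finite K"
      using F S unfolding K_def set_mult_def SET_INV_def by auto
  qed
  have FK: "F \<subseteq> K"
  proof
    fix f assume "f \<in> F"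
    then show "f \<in> K"
      using inK[of f \<one> \<one>] F S by (auto simp: subset_iff)
  qed
  have SK: "S \<subseteq> K"
  proof
    fix s assume "s \<in> S"
    then show "s \<in> K"
      using inK[of \<one> s \<one>] F S by (auto simp: subset_iff)
  qed
  have meas: "\<phi> g \<in> measurable M M" if "g \<in> carrier G" for g
    using act that by (simp add: pmp_action_def)
  have sp: "\<phi> g x \<in> space M" if "g \<in> carrier G" "x \<in> space M" for g x
    using measurable_space[OF meas] that by blast
  have pre: "{x \<in> space M. \<phi> g x \<in> A} \<in> sets M" if "g \<in> carrier G" for g
    using measurable_sets[OF meas[OF that] A] by (simp add: vimage_def Int_def conj_commute)
  \<comment> \<open>The enumeration \<open>r\<close> of \<open>F\<close> makes the choice of a star measurable: \<open>x\<close> takes the first \<open>f\<close> that works.\<close>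
  obtain r :: "'g \<Rightarrow> nat" where r: "inj_on r F"
    using finite_imp_inj_to_nat_seg[OF F(1)] by blast
  define star where "star f = {x \<in> space M. \<phi> f x \<in> A} - (\<Union>f'\<in>{f' \<in> F. r f' < r f}. {x \<in> space M. \<phi> f' x \<in> A})" for f
  define link where "link g = {x \<in> space M. x \<in> A \<and> \<phi> g x \<in> A}" for g
  define U where "U = {x \<in> space M. \<forall>f\<in>F. \<phi> f x \<notin> A}"
  define D where "D g = (if g \<in> F then star g else {}) \<union> (if g \<in> K - {\<one>} then link g else {})
      \<union> (if g \<in> S then U else {})" for g
  have star: "star f \<in> sets M" if "f \<in> F" for f
    unfolding star_def using F that pre by (intro sets.Diff sets.finite_UN) auto
  have link: "link g \<in> sets M" if "g \<in> K" for g
  proof -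
    have "link g = A \<inter> {x \<in> space M. \<phi> g x \<in> A}"
      using sets.sets_into_space[OF A] unfolding link_def by blast
    then show ?thesis using A pre K(2) that by auto
  qed
  have U: "U \<in> sets M"
  proof -
    have "U = space M - (\<Union>f\<in>F. {x \<in> space M. \<phi> f x \<in> A})"
      unfolding U_def by blast
    also have "\<dots> \<in> sets M"
      using F pre by (intro sets.Diff sets.top sets.finite_UN) auto
    finally show ?thesis .
  qed
  have D: "D g \<in> sets M" for g
    unfolding D_def using star link U by (intro sets.Un) auto
  define E where "E = {(x, \<phi> g x) | g x. g \<in> K \<and> x \<in> D g}"
  have EI: "(x, \<phi> g x) \<in> E" if "g \<in> K" "x \<in> D g" for g x
    using that unfolding E_def by blast
  have U_edge: "(x, \<phi> s x) \<in> E" if "s \<in> S" "x \<in> U" for s x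
    using that SK by (intro EI) (auto simp: D_def)
  have star_edge: "\<exists>f\<in>F. \<phi> f x \<in> A \<and> (x, \<phi> f x) \<in> E" if x: "x \<in> space M" "x \<notin> U" for x
  proof -
    have "\<exists>f. f \<in> F \<and> \<phi> f x \<in> A"
      using x by (auto simp: U_def)
    then obtain f where f: "f \<in> F" "\<phi> f x \<in> A"
      and min: "\<And>f'. f' \<in> F \<Longrightarrow> \<phi> f' x \<in> A \<Longrightarrow> r f \<le> r f'"
      using ex_has_least_nat[of "\<lambda>f. f \<in> F \<and> \<phi> f x \<in> A" _ r] by blast
    then have "x \<in> star f"
      using x(1) by (fastforce simp: star_def)
    then show ?thesis
      using f FK by (intro bexI[of _ f] conjI EI) (auto simp: D_def)
  qed
  have conn: "(x, \<phi> s x) \<in> (E \<union> E\<inverse>)\<^sup>*" if x: "x \<in> space M" and s: "s \<in> S" for x s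
  proof -
    have sG: "s \<in> carrier G" and y: "\<phi> s x \<in> space M"
      using s S sp x by auto
    consider "x \<in> U" | "\<phi> s x \<in> U" | "x \<notin> U" "\<phi> s x \<notin> U" by blast
    then show ?thesis
    proof cases
      case 1
      then show ?thesis using U_edge s by auto
    next
      case 2
      have "inv s \<in> S"
        using s S(4) unfolding SET_INV_def by blast
      then have "(\<phi> s x, \<phi> (inv s) (\<phi> s x)) \<in> E"
        using U_edge 2 by blast
      then show ?thesis
        using orbit_sym_aux[OF sG x refl] by auto
    next
      case 3
      obtain f where f: "f \<in> F" "\<phi> f x \<in> A" "(x, \<phi> f x) \<in> E"
        using star_edge[OF x 3(1)] by blast
      obtain f' where f': "f' \<in> F" "\<phi> f' (\<phi> s x) \<in> A" "(\<phi> s x, \<phi> f' (\<phi> s x)) \<in> E"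
        using star_edge[OF y 3(2)] by blast
      define g where "g = f' \<otimes> s \<otimes> inv f"
      have G: "f \<in> carrier G" "f' \<in> carrier G" "inv f \<in> carrier G"
        using f f' F by auto
      have gK: "g \<in> K"
        unfolding g_def using f f' s by (intro inK)
      have fx: "\<phi> f x \<in> space M"
        using sp G x by blast
      have "\<phi> g (\<phi> f x) = \<phi> f' (\<phi> s x)"
      proof -
        have "\<phi> g (\<phi> f x) = \<phi> (f' \<otimes> s) (\<phi> (inv f) (\<phi> f x))"
          unfolding g_def using G sG by (intro composition_rule[OF fx]) auto
        also have "\<dots> = \<phi> (f' \<otimes> s) x"
          using orbit_sym_aux[OF G(1) x refl] by simp
        also have "\<dots> = \<phi> f' (\<phi> s x)"
          using G sG by (intro composition_rule[OF x]) auto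
        finally show ?thesis .
      qed
      moreover have "(\<phi> f x, \<phi> g (\<phi> f x)) \<in> (E \<union> E\<inverse>)\<^sup>*"
      proof (cases "g = \<one>")
        case True
        then show ?thesis
          using id_eq_one fx by (metis restrict_apply' rtrancl.rtrancl_refl)
      next
        case False
        then have "\<phi> f x \<in> D g"
          using gK f f' fx calculation by (auto simp: D_def link_def)
        then show ?thesis using EI[OF gK] by auto
      qed
      ultimately have "(\<phi> f x, \<phi> f' (\<phi> s x)) \<in> (E \<union> E\<inverse>)\<^sup>*"
        by simp
      moreover have "(x, \<phi> f x) \<in> (E \<union> E\<inverse>)\<^sup>*" "(\<phi> f' (\<phi> s x), \<phi> s x) \<in> (E \<union> E\<inverse>)\<^sup>*"
        using f f' by auto
      ultimately show ?thesis
        by (meson rtrancl_trans)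
    qed
  qed
  have "cost M (orbit_rel G M \<phi>) \<le> (\<Sum>g\<in>K. emeasure M (D g))"
    by (rule cost_orbit_rel_le_sum[OF act S(3,2) K D E_def conn])
  also have "\<dots> \<le> (\<Sum>g\<in>K. (if g \<in> F then emeasure M (star g) else 0)
      + (if g \<in> S then emeasure M U else 0) + (if g \<in> K - {\<one>} then emeasure M (link g) else 0))"
  proof (rule sum_mono)
    fix g assume "g \<in> K"
    have "emeasure M (D g) \<le> emeasure M (if g \<in> F then star g else {})
        + emeasure M (if g \<in> K - {\<one>} then link g else {}) + emeasure M (if g \<in> S then U else {})"
      unfolding D_def using star link U
      by (intro order_trans[OF emeasure_subadditive] add_mono order_refl) auto
    then show "emeasure M (D g) \<le> (if g \<in> F then emeasure M (star g) else 0)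
        + (if g \<in> S then emeasure M U else 0) + (if g \<in> K - {\<one>} then emeasure M (link g) else 0)"
      by (auto simp: ac_simps split: if_splits)
  qed
  also have "\<dots> = (\<Sum>f\<in>F. emeasure M (star f)) + of_nat (card S) * emeasure M U
      + (\<Sum>g\<in>K - {\<one>}. emeasure M (link g))"
  proof -
    have restrict: "(\<Sum>g\<in>K. if g \<in> B then c g else 0) = sum c B" if "B \<subseteq> K"
      for B and c :: "'g \<Rightarrow> ennreal"
      using sum.inter_restrict[OF K(1), of c B] that by (simp add: Int_absorb1)
    show ?thesis
      unfolding sum.distrib using restrict[OF FK] restrict[OF SK] restrict[of "K - {\<one>}"] by simp
  qed
  also have "(\<Sum>f\<in>F. emeasure M (star f)) = emeasure M (\<Union>f\<in>F. star f)"
  proof (rule sum_emeasure)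
    show "disjoint_family_on star F"
      unfolding disjoint_family_on_def
    proof (intro ballI impI)
      fix f f' assume "f \<in> F" "f' \<in> F" "f \<noteq> f'"
      then have "r f < r f' \<or> r f' < r f"
        using r by (metis inj_onD linorder_neqE_nat)
      then show "star f \<inter> star f' = {}"
        using \<open>f \<in> F\<close> \<open>f' \<in> F\<close> by (auto simp: star_def)
    qed
  qed (use star F in auto)
  also have "emeasure M (\<Union>f\<in>F. star f) \<le> emeasure M (space M)"
    by (rule emeasure_space)
  finally show ?thesis
    unfolding K_def U_def link_def by (simp add: add_mono)
qed

section \<open>Fixed price one\<close>

lemma (in group) countable_generate:
  assumes "finite S" "S \<subseteq> carrier G" "set_inv S = S"
  shows "countable (generate G S)"
proof -
  have "generate G S \<subseteq> (\<lambda>xs. foldr (\<otimes>) xs \<one>) ` lists S"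
  proof
    fix g assume "g \<in> generate G S"
    then have "\<exists>xs\<in>lists S. g = foldr (\<otimes>) xs \<one>"
    proof induction
      case one
      show ?case by (intro bexI[of _ "[]"]) auto
    next
      case (incl s)
      then show ?case using assms(2) by (intro bexI[of _ "[s]"]) auto
    next
      case (inv s)
      then have "inv s \<in> S" using assms(3) unfolding SET_INV_def by blast
      then show ?case using assms(2) by (intro bexI[of _ "[inv s]"]) auto
    next
      case (eng g h)
      then obtain xs ys where xs: "xs \<in> lists S" "g = foldr (\<otimes>) xs \<one>"
        and ys: "ys \<in> lists S" "h = foldr (\<otimes>) ys \<one>" by blast
      have cl: "foldr (\<otimes>) zs \<one> \<in> carrier G" if "zs \<in> lists S" for zs
        using that assms(2) by (induction zs) auto
      have "foldr (\<otimes>) (xs @ ys) \<one> = g \<otimes> h"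
        unfolding xs(2) using xs(1)
      proof (induction xs)
        case Nil
        then show ?case using cl[OF ys(1)] ys(2) by simp
      next
        case (Cons z zs)
        then show ?case using cl[of zs] cl[OF ys(1)] ys(2) assms(2) by (auto simp: m_assoc)
      qed
      then show ?case using xs ys by (intro bexI[of _ "xs @ ys"]) auto
    qed
    then show "g \<in> (\<lambda>xs. foldr (\<otimes>) xs \<one>) ` lists S" by blast
  qed
  then show ?thesis
    by (rule countable_subset) (intro countable_image countable_lists countable_finite assms(1))
qed

lemma essentially_free_imp_AE_inj_on:
  fixes G (structure)
  assumes act: "pmp_action G M \<phi>" and free: "essentially_free G M \<phi>" and K: "K \<subseteq> carrier G"
  shows "AE x in M. inj_on (\<lambda>g. \<phi> g x) K"
proof -
  interpret group_action G "space M" \<phi>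
    using act by (simp add: pmp_action_def)
  interpret group G
    using group_hom by (rule group_hom.axioms(1))
  have inj: "inj_on (\<lambda>g. \<phi> g x) K"
    if x: "x \<in> space M" and free_x: "\<forall>g\<in>carrier G. g \<noteq> \<one> \<longrightarrow> \<phi> g x \<noteq> x" for x
  proof (rule inj_onI)
    fix g h assume gh: "g \<in> K" "h \<in> K" "\<phi> g x = \<phi> h x"
    then have c: "g \<in> carrier G" "h \<in> carrier G" "inv h \<in> carrier G"
      using K by auto
    have "\<phi> (inv h \<otimes> g) x = \<phi> (inv h) (\<phi> h x)"
      using composition_rule[OF x c(3,1)] gh(3) by simp
    also have "\<dots> = x"
      using orbit_sym_aux[OF c(2) x refl] .
    finally have "inv h \<otimes> g = \<one>"
      using free_x c by auto
    then show "g = h"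
      using c by (metis inv_equality inv_inv)
  qed
  show ?thesis
    using free AE_space[of M] unfolding essentially_free_def by eventually_elim (rule inj)
qed

text \<open>
  Here \<open>k\<close> and \<open>K\<close> stand for the cardinalities of the sets \<open>F\<close> and \<open>F S F\<inverse>\<close>, and \<open>p = c / k n\<close>.
  The constant \<open>c\<close> is fixed first, so large that \<open>a exp (- c)\<close> is small, and then \<open>n\<close> so that
  \<open>c\<^sup>2 K n / (k n)\<^sup>2\<close> is small. The latter also bounds \<open>p\<close>, since \<open>c \<ge> 1\<close> and \<open>k n \<le> K n\<close>.
\<close>
lemma exists_bernoulli_parameter:
  fixes a :: real and k K :: "nat \<Rightarrow> real"
  assumes lim: "(\<lambda>n. K n / (k n)\<^sup>2) \<longlonglongrightarrow> 0" and k: "\<And>n. 1 \<le> k n" "\<And>n. k n \<le> K n"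
    and a: "0 \<le> a" and \<epsilon>: "0 < \<epsilon>"
  obtains n p where "0 \<le> p" "p \<le> 1" "p + a * exp (- (p * k n)) + K n * p\<^sup>2 < \<epsilon>"
proof -
  define c where "c = 1 + 3 * a / \<epsilon>"
  have c: "1 \<le> c"
    using a \<epsilon> by (simp add: c_def)
  have "3 * a / \<epsilon> < exp c"
    using exp_ge_add_one_self[of c] by (simp add: c_def)
  then have ac: "a * exp (- c) < \<epsilon> / 3"
    using \<epsilon> by (simp add: exp_minus field_simps)
  have "0 < min 1 (\<epsilon> / 3) / c\<^sup>2"
    using c \<epsilon> by simp
  then have "\<forall>\<^sub>F n in sequentially. K n / (k n)\<^sup>2 < min 1 (\<epsilon> / 3) / c\<^sup>2"
    using lim by (intro order_tendstoD)
  then obtain n where n: "K n / (k n)\<^sup>2 < min 1 (\<epsilon> / 3) / c\<^sup>2"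
    using eventually_happens'[OF sequentially_bot] by blast
  define p where "p = c / k n"
  have k0: "0 < k n"
    using k(1)[of n] by simp
  have Kp: "K n * p\<^sup>2 = c\<^sup>2 * (K n / (k n)\<^sup>2)"
    by (simp add: p_def power_divide)
  also have "\<dots> < min 1 (\<epsilon> / 3)"
    using n c by (simp add: field_simps)
  finally have Kp_less: "K n * p\<^sup>2 < min 1 (\<epsilon> / 3)" .
  have "p \<le> c * p"
    using c k0 by (simp add: p_def field_simps)
  also have "\<dots> = k n * p\<^sup>2"
    using k0 by (simp add: p_def power2_eq_square)
  also have "\<dots> \<le> K n * p\<^sup>2"
    using k(2) by (intro mult_right_mono) auto
  finally have "p < min 1 (\<epsilon> / 3)"
    using Kp_less by simp
  moreover have "p * k n = c"
    using k0 by (simp add: p_def)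
  moreover have "0 \<le> p"
    using c k0 by (simp add: p_def)
  ultimately show ?thesis
    using ac Kp_less by (intro that[of p n]) auto
qed

theorem theorem1p1:
  fixes G :: "('g, 'b) monoid_scheme" (structure)
    and S :: "'g set" and F :: "nat \<Rightarrow> 'g set"
  assumes "group G"
    and "finite S" and "S \<subseteq> carrier G" and "generate G S = carrier G"
    and "set_inv S = S" and "\<one> \<in> S"
    and "\<And>n. finite (F n)" and "\<And>n. F n \<subseteq> carrier G" and "\<And>n. \<one> \<in> F n"
    and "(\<lambda>n. real (card (F n <#> S <#> set_inv (F n))) / (real (card (F n)))\<^sup>2) \<longlonglongrightarrow> 0"
  shows "fixed_price_one TYPE('x) G"
  unfolding fixed_price_one_def
proof (intro conjI allI impI)
  interpret group G by fact
  show "countable (carrier G)"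
    using countable_generate[OF assms(2,3,5)] assms(4) by simp
  fix M :: "'x measure" and \<phi>
  assume "standard_prob_space M \<and> pmp_action G M \<phi> \<and> essentially_free G M \<phi>"
  then have M: "prob_space M" "standard_borel M" and act: "pmp_action G M \<phi>"
    and free: "essentially_free G M \<phi>"
    by (auto simp: standard_prob_space_def)
  interpret prob_space M by (rule M)
  interpret group_action G "space M" \<phi>
    using act by (simp add: pmp_action_def)
  have meas: "\<phi> g \<in> measurable M M" if "g \<in> carrier G" for g
    using act that by (simp add: pmp_action_def)
  define K where "K n = F n <#> S <#> set_inv (F n)" for n
  have K: "finite (K n)" "K n \<subseteq> carrier G" "F n \<subseteq> K n" for n
  proof -
    show "K n \<subseteq> carrier G"
      using assms(3) assms(8)[of n] unfolding K_def set_mult_def SET_INV_def by auto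
    show "finite (K n)"
      using assms(2,7) unfolding K_def set_mult_def SET_INV_def by auto
    show "F n \<subseteq> K n"
    proof
      fix f assume f: "f \<in> F n"
      then have "f \<otimes> \<one> \<otimes> inv \<one> \<in> K n"
        using assms(6,9) unfolding K_def set_mult_def SET_INV_def by blast
      moreover have "f \<in> carrier G"
        using f assms(8) by blast
      ultimately show "f \<in> K n"
        by simp
    qed
  qed
  define U where "U n A = {x \<in> space M. \<forall>f\<in>F n. \<phi> f x \<notin> A}" for n A
  define link where "link A g = {x \<in> space M. x \<in> A \<and> \<phi> g x \<in> A}" for A g
  \<comment> \<open>One set \<open>A\<close> serves both bounds: the first two terms give a small complete section, the last two a cheap graphing.\<close>
  have small: "\<exists>n. \<exists>A\<in>sets M. emeasure M A + of_nat (card S) * emeasure M (U n A)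
      + (\<Sum>g\<in>K n - {\<one>}. emeasure M (link A g)) < ennreal \<epsilon>" if \<epsilon>: "0 < \<epsilon>" for \<epsilon> :: real
  proof -
    have k: "1 \<le> real (card (F n))" "real (card (F n)) \<le> real (card (K n))" for n
      using assms(7,9)[of n] K[of n] card_mono[of "K n" "F n"]
      by (auto simp: Suc_le_eq card_gt_0_iff)
    obtain n p where p: "0 \<le> p" "p \<le> 1"
      and less: "p + real (card S) * exp (- (p * real (card (F n)))) + real (card (K n)) * p\<^sup>2 < \<epsilon>"
      by (rule exists_bernoulli_parameter[where a = "real (card S)",
            OF assms(10)[folded K_def] k of_nat_0_le_iff \<epsilon>])
    have exp: "(1 - p) ^ card (F n) \<le> exp (- (p * real (card (F n))))"
    proof -
      have "(1 - p) ^ card (F n) \<le> exp (- p) ^ card (F n)"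
        using p exp_ge_add_one_self[of "- p"] by (intro power_mono) auto
      also have "\<dots> = exp (- (p * real (card (F n))))"
        by (simp add: exp_of_nat_mult[symmetric] mult.commute)
      finally show ?thesis .
    qed
    define b where "b = p + real (card S) * (1 - p) ^ card (F n) + real (card (K n)) * p\<^sup>2"
    have "b < \<epsilon>"
      using less mult_left_mono[OF exp, of "real (card S)"] by (simp add: b_def)
    then have "0 < \<epsilon> - b"
      by simp
    from exists_almost_independent_set[OF M K(1)[of n] K(3)[of n] _ meas _
        essentially_free_imp_AE_inj_on[OF act free K(2)] p this, of \<one> "card S"]
    have "\<exists>A\<in>sets M. emeasure M A + of_nat (card S) * emeasure M (U n A)
        + (\<Sum>g\<in>K n - {\<one>}. emeasure M (link A g)) < ennreal (b + (\<epsilon> - b))"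
      unfolding U_def link_def b_def
      using K assms(9) by (auto simp: subset_iff simp flip: id_eq_one)
    then show ?thesis
      by auto
  qed
  have upper: "cost M (orbit_rel G M \<phi>) \<le> 1"
  proof (rule ennreal_le_epsilon)
    fix \<epsilon> :: real assume "0 < \<epsilon>"
    then obtain n A where A: "A \<in> sets M" "emeasure M A + of_nat (card S) * emeasure M (U n A)
        + (\<Sum>g\<in>K n - {\<one>}. emeasure M (link A g)) < ennreal \<epsilon>"
      using small by blast
    have "cost M (orbit_rel G M \<phi>) \<le> 1 + of_nat (card S) * emeasure M (U n A)
        + (\<Sum>g\<in>K n - {\<one>}. emeasure M (link A g))"
      using cost_le_stars_links_uncovered[OF act assms(2-6) assms(7-9)[of n] A(1)]
      unfolding U_def link_def K_def by (simp add: emeasure_space_1)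
    also have "\<dots> \<le> 1 + (emeasure M A + of_nat (card S) * emeasure M (U n A)
        + (\<Sum>g\<in>K n - {\<one>}. emeasure M (link A g)))"
      by (simp add: add.assoc add_left_mono add_increasing)
    also have "\<dots> \<le> 1 + ennreal \<epsilon>"
      using A(2) by (intro add_left_mono) simp
    finally show "cost M (orbit_rel G M \<phi>) \<le> 1 + ennreal \<epsilon>" .
  qed
  have lower: "1 \<le> graphing_cost M I A"
    if gr: "graphing M (orbit_rel G M \<phi>) I A B f" and gen: "generates M (orbit_rel G M \<phi>) I A f"
    for I A B f
  proof (rule ennreal_le_epsilon)
    fix \<epsilon> :: real assume "0 < \<epsilon>"
    then obtain n Y where Y: "Y \<in> sets M" "emeasure M Y + of_nat (card S) * emeasure M (U n Y)
        + (\<Sum>g\<in>K n - {\<one>}. emeasure M (link Y g)) < ennreal \<epsilon>"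
      using small by blast
    have U: "U n Y \<in> sets M"
    proof -
      have "{x \<in> space M. \<phi> f x \<in> Y} \<in> sets M" if "f \<in> F n" for f
        using measurable_sets[OF meas Y(1), of f] assms(8)[of n] that
        by (auto simp: vimage_def Int_def conj_commute)
      moreover have "U n Y = space M - (\<Union>f\<in>F n. {x \<in> space M. \<phi> f x \<in> Y})"
        unfolding U_def by blast
      ultimately show ?thesis
        using assms(7)[of n] by auto
    qed
    \<comment> \<open>A covered point reaches \<open>Y\<close> by an element of \<open>F n\<close>; an uncovered point is in the section itself.\<close>
    have meets: "orbit_rel G M \<phi> `` {x} \<inter> (Y \<union> U n Y) \<noteq> {}" if x: "x \<in> space M" for x
    proof (cases "x \<in> U n Y")
      case True
      then show ?thesis
        using x orbit_refl[OF x] by (auto simp: orbit_rel_def)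
    next
      case False
      then obtain f where "f \<in> F n" "\<phi> f x \<in> Y"
        using x by (auto simp: U_def)
      then have "\<phi> f x \<in> orbit_rel G M \<phi> `` {x} \<inter> Y"
        using x assms(8)[of n] by (auto simp: orbit_rel_def orbit_def)
      then show ?thesis by blast
    qed
    have "AE x in M. graph_component (graphing_edges I A f) x \<inter> (Y \<union> U n Y) \<noteq> {}"
      using gen AE_space[of M] unfolding generates_def
      by eventually_elim (simp only: meets not_False_eq_True)
    then have "emeasure M (space M) \<le> emeasure M (Y \<union> U n Y) + graphing_cost M I A"
      by (intro measure_space_le_section_plus_graphing_cost[OF gr]) (use Y U in auto)
    also have "emeasure M (Y \<union> U n Y) \<le> emeasure M Y + emeasure M (U n Y)"
      using Y U by (intro emeasure_subadditive)
    also have "emeasure M (U n Y) \<le> of_nat (card S) * emeasure M (U n Y)"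
    proof -
      have "1 \<le> card S"
        using assms(2,6) by (auto simp: Suc_le_eq card_gt_0_iff)
      then have "(1 :: ennreal) \<le> of_nat (card S)"
        by (metis of_nat_1 of_nat_mono)
      then show ?thesis
        using mult_right_mono[of 1 "of_nat (card S)" "emeasure M (U n Y)"] by simp
    qed
    also have "emeasure M Y + of_nat (card S) * emeasure M (U n Y) \<le> ennreal \<epsilon>"
      using Y(2) by (meson add_increasing2 less_imp_le order_refl order_trans zero_le)
    finally show "1 \<le> graphing_cost M I A + ennreal \<epsilon>"
      by (simp add: emeasure_space_1 add.commute add_left_mono add_right_mono)
  qed
  have "1 \<le> cost M (orbit_rel G M \<phi>)"
    unfolding cost_def by (rule Inf_greatest) (use lower in blast)
  with upper show "cost M (orbit_rel G M \<phi>) = 1"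
    by (rule antisym)
qed

end
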